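(* Let $\kappa$ be a weakly compact cardinal. Then for any set $S$ with $\mathrm{Reg}(\kappa)\subseteq S\subseteq\kappa$, $\clubsuit_{\mathrm{AD}}(\{S\},1,1)$ fails.
   Context: $\mathrm{Reg}(\kappa)$ is the set of all infinite regular cardinals below $\kappa$. $\mathrm{acc}(\kappa)$ is the set of nonzero limit ordinals below $\kappa$; $[\kappa]^\kappa$ is the set of subsets of $\kappa$ of size $\kappa$. A sequence $\langle \mathcal A_\alpha\mid\alpha\in S\rangle$ is an AD-multi-ladder system iff (i) for every $\alpha\in S\cap\mathrm{acc}(\kappa)$, $\mathcal A_\alpha$ is a nonempty family of pairwise disjoint cofinal subsets of $\alpha$, and (ii) for any two distinct $A,A'\in\bigcup_{\alpha\in S}\mathcal A_\alpha$, $\sup(A\cap A')<\sup(A)$. For a stationary $S\subseteq\kappa$, $\clubsuit_{\mathrm{AD}}(\{S\},1,1)$ asserts the existence of an AD-multi-ladder system $\langle\mathcal A_\alpha\mid\alpha\in S\rangle$ with $|\mathcal A_\alpha|=1$ for all $\alpha\in S$ such that for every $B\in[\kappa]^\kappa$ the set $\{\alpha\in S\mid \forall A\in\mathcal A_\alpha\ [\sup(A\cap B)=\alpha]\}$ is stationary. *)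

theory Defs
  imports Main "HOL-Library.Ramsey"
begin

unbundle cardinal_syntax

text \<open>
  A cardinal \<open>\<kappa>\<close> is a relation with \<^term>\<open>Card_order \<kappa>\<close>. The ordinals below \<open>\<kappa>\<close> are the elements of
  \<^term>\<open>Field \<kappa>\<close>; such an \<open>\<alpha>\<close> is, as a set of smaller ordinals, \<^term>\<open>underS \<kappa> \<alpha>\<close>, and as a
  well-order, \<^term>\<open>Restr \<kappa> (underS \<kappa> \<alpha>)\<close>.
\<close>

text \<open>
  The supremum of a set of ordinals is its union, hence is given here as an initial segment of
  \<open>\<kappa>\<close>: \<open>sup X = \<alpha>\<close> reads \<^term>\<open>osup \<kappa> X = underS \<kappa> \<alpha>\<close>, and \<open>sup X < sup Y\<close> reads
  \<^term>\<open>osup \<kappa> X \<subset> osup \<kappa> Y\<close>. The supremum of an unbounded set is the whole of \<^term>\<open>Field \<kappa>\<close>, that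
  of the empty set is \<open>0\<close>.
\<close>

definition osup :: "'a rel \<Rightarrow> 'a set \<Rightarrow> 'a set" where
  "osup \<kappa> X = (\<Union>x\<in>X. underS \<kappa> x)"

definition acc_ords :: "'a rel \<Rightarrow> 'a set" where
  "acc_ords \<kappa> = {\<alpha> \<in> Field \<kappa>. underS \<kappa> \<alpha> \<noteq> {} \<and> osup \<kappa> (underS \<kappa> \<alpha>) = underS \<kappa> \<alpha>}"

definition Reg :: "'a rel \<Rightarrow> 'a set" where
  "Reg \<kappa> = {\<alpha> \<in> Field \<kappa>. Cinfinite (Restr \<kappa> (underS \<kappa> \<alpha>)) \<and>
                         regularCard (Restr \<kappa> (underS \<kappa> \<alpha>))}"

definition full_subsets :: "'a rel \<Rightarrow> 'a set set" where
  "full_subsets \<kappa> = {B. B \<subseteq> Field \<kappa> \<and> |B| =o \<kappa>}"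

text \<open>Uncountable, with the partition property \<open>\<kappa> \<rightarrow> (\<kappa>)\<^sup>2\<^sub>2\<close>.\<close>

definition weakly_compact :: "'a rel \<Rightarrow> bool" where
  "weakly_compact \<kappa> \<longleftrightarrow> Card_order \<kappa> \<and> natLeq <o \<kappa> \<and>
     (\<forall>f :: 'a set \<Rightarrow> bool. \<exists>H \<in> full_subsets \<kappa>. \<exists>c. \<forall>X \<in> [H]\<^bsup>2\<^esup>. f X = c)"

definition club_in :: "'a rel \<Rightarrow> 'a set \<Rightarrow> bool" where
  "club_in \<kappa> C \<longleftrightarrow> C \<subseteq> Field \<kappa> \<and> cofinal C \<kappa> \<and>
     (\<forall>\<alpha> \<in> acc_ords \<kappa>. osup \<kappa> (C \<inter> underS \<kappa> \<alpha>) = underS \<kappa> \<alpha> \<longrightarrow> \<alpha> \<in> C)"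

definition stationary_in :: "'a rel \<Rightarrow> 'a set \<Rightarrow> bool" where
  "stationary_in \<kappa> T \<longleftrightarrow> T \<subseteq> Field \<kappa> \<and> (\<forall>C. club_in \<kappa> C \<longrightarrow> T \<inter> C \<noteq> {})"

text \<open>
  The first conjunct says that every \<open>\<A> \<alpha>\<close> with \<open>\<alpha> \<in> S\<close>, also for \<open>\<alpha>\<close> not a limit, is a family of
  sets of ordinals below \<open>\<kappa>\<close>.
\<close>

definition AD_multi_ladder_system :: "'a rel \<Rightarrow> 'a set \<Rightarrow> ('a \<Rightarrow> 'a set set) \<Rightarrow> bool" where
  "AD_multi_ladder_system \<kappa> S \<A> \<longleftrightarrow>
     (\<forall>\<alpha> \<in> S. \<A> \<alpha> \<subseteq> Pow (Field \<kappa>)) \<and>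
     (\<forall>\<alpha> \<in> S \<inter> acc_ords \<kappa>. \<A> \<alpha> \<noteq> {} \<and> pairwise disjnt (\<A> \<alpha>) \<and>
        (\<forall>A \<in> \<A> \<alpha>. A \<subseteq> underS \<kappa> \<alpha> \<and> cofinal A (Restr \<kappa> (underS \<kappa> \<alpha>)))) \<and>
     (\<forall>A \<in> (\<Union>\<alpha>\<in>S. \<A> \<alpha>). \<forall>A' \<in> (\<Union>\<alpha>\<in>S. \<A> \<alpha>). A \<noteq> A' \<longrightarrow> osup \<kappa> (A \<inter> A') \<subset> osup \<kappa> A)"

text \<open>The principle \<open>\<clubsuit>\<^sub>A\<^sub>D({S},1,1)\<close>.\<close>

definition clubsuit_AD_1_1 :: "'a rel \<Rightarrow> 'a set \<Rightarrow> bool" where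
  "clubsuit_AD_1_1 \<kappa> S \<longleftrightarrow>
     (\<exists>\<A>. AD_multi_ladder_system \<kappa> S \<A> \<and>
          (\<forall>\<alpha> \<in> S. card (\<A> \<alpha>) = 1) \<and>
          (\<forall>B \<in> full_subsets \<kappa>.
             stationary_in \<kappa> {\<alpha> \<in> S. \<forall>A \<in> \<A> \<alpha>. osup \<kappa> (A \<inter> B) = underS \<kappa> \<alpha>}))"

end

theory Submission
  imports Defs
begin

text \<open>
  Colouring pairs by the lexicographic order of \<open>\<kappa>\<close>-sequences of bits turns the partition property
  into the following: any \<open>\<kappa>\<close> many subsets of \<open>\<kappa>\<close> are eventually decided along some \<open>H\<close> of size
  \<open>\<kappa>\<close>. Deciding the level sets of all composites of \<open>\<kappa>\<close> many regressive functions, and picking a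
  composite that is minimal among those tending to \<open>\<kappa>\<close> along \<open>H\<close>, one obtains an unbounded \<open>L\<close> on
  which each of the given functions is eventually constant.

  Apply this to functions that witness singularity and to \<open>\<lambda> \<mapsto> (\<close>some element of \<open>A\<^sub>\<lambda>\<close> above
  \<open>\<delta>)\<close> for all \<open>\<delta>\<close>. The former show that \<open>L\<close> eventually consists of regular cardinals; the eventual
  values of the latter form an unbounded set \<open>B\<close> each of whose proper initial segments is contained
  in \<open>A\<^sub>\<lambda>\<close> for all large \<open>\<lambda> \<in> L\<close>. If \<open>A\<^sub>\<alpha> \<inter> B\<close> is cofinal in \<open>\<alpha>\<close>, so is \<open>A\<^sub>\<alpha> \<inter> A\<^sub>\<lambda>\<close> for such a
  \<open>\<lambda> > \<alpha>\<close>, against almost disjointness.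
\<close>

section \<open>Order and boundedness in a regular uncountable cardinal\<close>

lemma finite_ordLess_uncountable:
  assumes "natLeq <o r" "finite A"
  shows "|A| <o r"
  using assms(2)
  by (intro ordLess_transitive[OF finite_ordLess_infinite[OF card_of_Well_order natLeq_Well_order] assms(1)])
    (simp_all add: Field_natLeq Field_card_of)

locale regular_cardinal =
  fixes \<kappa> :: "'a rel"
  assumes Card_order: "Card_order \<kappa>"
    and uncountable: "natLeq <o \<kappa>"
    and regular: "regularCard \<kappa>"
begin

lemma Well_order: "Well_order \<kappa>"
  using Card_order by (simp add: card_order_on_def)

lemma infinite_Field: "infinite (Field \<kappa>)"
  using cinfinite_mono[OF ordLess_imp_ordLeq[OF uncountable] natLeq_cinfinite]
  by (simp add: cinfinite_def)

lemma wf_less: "wf (\<kappa> - Id)"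
  using Well_order by (simp add: well_order_on_def)

lemma underS_in_Field: "x \<in> underS \<kappa> y \<Longrightarrow> x \<in> Field \<kappa>" "x \<in> underS \<kappa> y \<Longrightarrow> y \<in> Field \<kappa>"
  by (auto simp: underS_def Field_def)

lemma underS_trans: "x \<in> underS \<kappa> y \<Longrightarrow> y \<in> underS \<kappa> z \<Longrightarrow> x \<in> underS \<kappa> z"
  using Well_order unfolding order_on_defs underS_def by (auto dest: transD antisymD)

lemma underS_asym: "x \<in> underS \<kappa> y \<Longrightarrow> y \<notin> underS \<kappa> x"
  using underS_trans underS_notIn by metis

lemma underS_total:
  "x \<in> Field \<kappa> \<Longrightarrow> y \<in> Field \<kappa> \<Longrightarrow> x \<in> underS \<kappa> y \<or> x = y \<or> y \<in> underS \<kappa> x"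
  using Well_order unfolding order_on_defs total_on_def underS_def by auto

lemma underS_induct [consumes 1, case_names less]:
  assumes "x \<in> Field \<kappa>" "\<And>x. x \<in> Field \<kappa> \<Longrightarrow> (\<And>y. y \<in> underS \<kappa> x \<Longrightarrow> P y) \<Longrightarrow> P x"
  shows "P x"
  using wf_less assms(1)
proof (induction x rule: wf_induct_rule)
  case (less x)
  show ?case
  proof (rule assms(2))
    fix y assume "y \<in> underS \<kappa> x"
    then show "P y"
      using less.IH by (auto simp: underS_def Field_def)
  qed (rule less.prems)
qed

lemma least_in_Field:
  assumes "x \<in> Field \<kappa>" "P x"
  obtains m where "m \<in> Field \<kappa>" "P m" "\<And>y. y \<in> underS \<kappa> m \<Longrightarrow> \<not> P y"
proof -
  have "P x \<Longrightarrow> \<exists>m\<in>Field \<kappa>. P m \<and> (\<forall>y\<in>underS \<kappa> m. \<not> P y)"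
    using assms(1) by (induction rule: underS_induct) blast
  then show thesis
    using that assms by blast
qed

lemma above_exists: "x \<in> Field \<kappa> \<Longrightarrow> \<exists>y\<in>Field \<kappa>. x \<in> underS \<kappa> y"
  using infinite_Card_order_limit[OF Card_order infinite_Field] by (auto simp: underS_def)

lemma small_bounded:
  assumes "K \<subseteq> Field \<kappa>" "|K| <o \<kappa>"
  obtains b where "b \<in> Field \<kappa>" "K \<subseteq> underS \<kappa> b"
proof -
  have "\<not> cofinal K \<kappa>"
    using assms regular not_ordLess_ordIso unfolding regularCard_def by blast
  then obtain a where a: "a \<in> Field \<kappa>" "\<And>b. b \<in> K \<Longrightarrow> a \<notin> underS \<kappa> b"
    by (auto simp: cofinal_def underS_def)
  \<comment> \<open>\<open>cofinal\<close> is strict, so its failure only yields x \<le> a for the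
    elements x of \<open>K\<close>; moving to some b above a makes the bound strict.\<close>
  obtain b where b: "b \<in> Field \<kappa>" "a \<in> underS \<kappa> b"
    using above_exists a(1) by blast
  have "K \<subseteq> underS \<kappa> b"
  proof
    fix x assume "x \<in> K"
    then have "x \<in> underS \<kappa> a \<or> x = a"
      using underS_total a assms(1) by blast
    then show "x \<in> underS \<kappa> b"
      using b underS_trans by blast
  qed
  then show thesis
    using that b by blast
qed

lemma small_image_bounded:
  assumes "f ` I \<subseteq> Field \<kappa>" "|I| <o \<kappa>"
  obtains b where "b \<in> Field \<kappa>" "\<And>i. i \<in> I \<Longrightarrow> f i \<in> underS \<kappa> b"
proof -
  have "|f ` I| <o \<kappa>"
    using card_of_image assms(2) ordLeq_ordLess_trans by blast
  then obtain b where "b \<in> Field \<kappa>" "f ` I \<subseteq> underS \<kappa> b"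
    using small_bounded assms(1) by blast
  then show thesis
    using that by blast
qed

lemma small_underS: "a \<in> Field \<kappa> \<Longrightarrow> |underS \<kappa> a| <o \<kappa>"
  by (rule card_of_underS[OF Card_order])

lemma small_nat: "|UNIV :: nat set| <o \<kappa>"
  by (rule ordIso_ordLess_trans[OF card_of_nat uncountable])

section \<open>Unbounded sets and the filter of their tails\<close>

definition unbounded :: "'a set \<Rightarrow> bool" where
  "unbounded L \<longleftrightarrow> L \<subseteq> Field \<kappa> \<and> (\<forall>a\<in>Field \<kappa>. \<exists>x\<in>L. a \<in> underS \<kappa> x)"

lemma unbounded_imp_full:
  assumes "unbounded L"
  shows "L \<in> full_subsets \<kappa>"
proof -
  have "L \<subseteq> Field \<kappa>" "cofinal L \<kappa>"
    using assms by (auto simp: unbounded_def cofinal_def underS_def)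
  then show ?thesis
    using regular by (simp add: regularCard_def full_subsets_def)
qed

lemma full_imp_unbounded:
  assumes "L \<in> full_subsets \<kappa>"
  shows "unbounded L"
  unfolding unbounded_def
proof (intro conjI ballI)
  show sub: "L \<subseteq> Field \<kappa>"
    using assms by (simp add: full_subsets_def)
  fix a assume a: "a \<in> Field \<kappa>"
  show "\<exists>x\<in>L. a \<in> underS \<kappa> x"
  proof (rule ccontr)
    assume none: "\<not> (\<exists>x\<in>L. a \<in> underS \<kappa> x)"
    obtain b where b: "b \<in> Field \<kappa>" "a \<in> underS \<kappa> b"
      using above_exists a by blast
    have "L \<subseteq> underS \<kappa> b"
      using none b sub a underS_total underS_trans by blast
    then have "|L| <o \<kappa>"
      using ordLeq_ordLess_trans[OF card_of_mono1 small_underS[OF b(1)]] by blast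
    then show False
      using assms not_ordLess_ordIso by (auto simp: full_subsets_def)
  qed
qed

text \<open>The filter generated by the tails of \<open>L\<close>. It is \<kappa>-complete by
  regularity (\<open>ev_ball\<close>) and proper for unbounded \<open>L\<close>
  (\<open>ev_exists\<close>).\<close>

definition ev :: "'a set \<Rightarrow> ('a \<Rightarrow> bool) \<Rightarrow> bool" where
  "ev L P \<longleftrightarrow> (\<exists>b\<in>Field \<kappa>. \<forall>x\<in>L. b \<in> underS \<kappa> x \<longrightarrow> P x)"

lemma ev_above: "a \<in> Field \<kappa> \<Longrightarrow> ev L (\<lambda>x. a \<in> underS \<kappa> x)"
  unfolding ev_def by blast

lemma ev_ball:
  assumes "|I| <o \<kappa>" "\<And>i. i \<in> I \<Longrightarrow> ev L (P i)"
  shows "ev L (\<lambda>x. \<forall>i\<in>I. P i x)"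
proof -
  obtain b where b: "\<And>i. i \<in> I \<Longrightarrow> b i \<in> Field \<kappa>"
    "\<And>i x. i \<in> I \<Longrightarrow> x \<in> L \<Longrightarrow> b i \<in> underS \<kappa> x \<Longrightarrow> P i x"
    using assms(2) unfolding ev_def by metis
  obtain c where c: "c \<in> Field \<kappa>" "\<And>i. i \<in> I \<Longrightarrow> b i \<in> underS \<kappa> c"
    using small_image_bounded[of b I] assms(1) b(1) by blast
  have "P i x" if "x \<in> L" "c \<in> underS \<kappa> x" "i \<in> I" for x i
    using b(2)[OF that(3,1)] underS_trans[OF c(2)[OF that(3)] that(2)] .
  then show ?thesis
    unfolding ev_def using c(1) by blast
qed

lemma ev_mono: "ev L P \<Longrightarrow> (\<And>x. x \<in> L \<Longrightarrow> P x \<Longrightarrow> Q x) \<Longrightarrow> ev L Q"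
  unfolding ev_def by blast

lemma ev_conj:
  assumes "ev L P" "ev L Q"
  shows "ev L (\<lambda>x. P x \<and> Q x)"
proof -
  obtain a b where a: "a \<in> Field \<kappa>" "\<And>x. x \<in> L \<Longrightarrow> a \<in> underS \<kappa> x \<Longrightarrow> P x"
    and b: "b \<in> Field \<kappa>" "\<And>x. x \<in> L \<Longrightarrow> b \<in> underS \<kappa> x \<Longrightarrow> Q x"
    using assms unfolding ev_def by blast
  obtain c where c: "c \<in> Field \<kappa>" "a \<in> underS \<kappa> c" "b \<in> underS \<kappa> c"
    using above_exists underS_total[OF a(1) b(1)] underS_trans a(1) b(1) by metis
  have "P x \<and> Q x" if "x \<in> L" "c \<in> underS \<kappa> x" for x
    using a(2) b(2) that underS_trans[OF c(2) that(2)] underS_trans[OF c(3) that(2)] by blast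
  then show ?thesis
    unfolding ev_def using c(1) by blast
qed

lemma ev_exists: "unbounded L \<Longrightarrow> ev L P \<Longrightarrow> \<exists>x\<in>L. P x"
  unfolding unbounded_def ev_def by blast

section \<open>Limit ordinals, regular cardinals and singular ordinals below \<kappa>\<close>

lemma cofinal_acc_ords: "cofinal (acc_ords \<kappa>) \<kappa>"
  unfolding cofinal_def
proof
  fix a assume a: "a \<in> Field \<kappa>"
  obtain s where s: "\<And>x. x \<in> Field \<kappa> \<Longrightarrow> s x \<in> Field \<kappa> \<and> x \<in> underS \<kappa> (s x)"
    using above_exists by metis
  define u where "u n = (s ^^ n) a" for n
  have u_Field: "u n \<in> Field \<kappa>" for n
    by (induction n) (use a s in \<open>auto simp: u_def\<close>)
  have u_less: "u n \<in> underS \<kappa> (u (Suc n))" for n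
    using s[OF u_Field] by (simp add: u_def)
  \<comment> \<open>An \<omega>-sequence is bounded, as \<kappa> is regular and uncountable. Its
    least strict bound b is the required limit: anything below b is passed by some
    \<open>u n\<close>.\<close>
  obtain c where "c \<in> Field \<kappa>" "\<And>n. u n \<in> underS \<kappa> c"
    using small_image_bounded[of u "UNIV :: nat set"] small_nat u_Field by (metis UNIV_I image_subsetI)
  then have "c \<in> Field \<kappa>" "\<forall>n. u n \<in> underS \<kappa> c"
    by auto
  then obtain b where b: "b \<in> Field \<kappa>" "\<forall>n. u n \<in> underS \<kappa> b"
    and least: "\<And>y. y \<in> underS \<kappa> b \<Longrightarrow> \<not> (\<forall>n. u n \<in> underS \<kappa> y)"
    by (rule least_in_Field[where P = "\<lambda>b. \<forall>n. u n \<in> underS \<kappa> b"]) blast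
  have "osup \<kappa> (underS \<kappa> b) = underS \<kappa> b"
  proof
    show "osup \<kappa> (underS \<kappa> b) \<subseteq> underS \<kappa> b"
      using underS_trans by (auto simp: osup_def)
    show "underS \<kappa> b \<subseteq> osup \<kappa> (underS \<kappa> b)"
    proof
      fix x assume x: "x \<in> underS \<kappa> b"
      then obtain n where "u n \<notin> underS \<kappa> x"
        using least by blast
      then have "x \<in> underS \<kappa> (u (Suc n))"
        using underS_total[OF u_Field[of n] underS_in_Field(1)[OF x]] u_less underS_trans by blast
      then show "x \<in> osup \<kappa> (underS \<kappa> b)"
        using b by (auto simp: osup_def)
    qed
  qed
  then have "b \<in> acc_ords \<kappa>"
    using b unfolding acc_ords_def by blast
  moreover have "a \<in> underS \<kappa> b"
    using b(2)[rule_format, of 0] by (simp add: u_def)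
  ultimately show "\<exists>b\<in>acc_ords \<kappa>. a \<noteq> b \<and> (a, b) \<in> \<kappa>"
    by (auto simp: underS_def)
qed

text \<open>Stationary sets meet this club, so guessing takes place at some limit ordinal, where the
  ladder clauses apply. Closedness is immediate because \<open>club_in\<close> only tests limit
  ordinals.\<close>

lemma club_acc_ords: "club_in \<kappa> (acc_ords \<kappa>)"
  using cofinal_acc_ords by (auto simp: club_in_def acc_ords_def)

lemma Field_Restr_underS: "Field (Restr \<kappa> (underS \<kappa> a)) = underS \<kappa> a"
  using Well_order by (intro Refl_Field_Restr2 Order_Relation.underS_Field) (simp add: order_on_defs)

text \<open>An infinite cardinal has no largest element. Hence the ladders at members of
  \<open>Reg \<kappa>\<close> are genuinely cofinal.\<close>

lemma Reg_subset_acc_ords: "Reg \<kappa> \<subseteq> acc_ords \<kappa>"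
proof
  fix l assume l: "l \<in> Reg \<kappa>"
  let ?r = "Restr \<kappa> (underS \<kappa> l)"
  have inf: "infinite (Field ?r)" and card: "Card_order ?r"
    using l by (auto simp: Reg_def cinfinite_def)
  have "underS \<kappa> l \<subseteq> osup \<kappa> (underS \<kappa> l)"
    using infinite_Card_order_limit[OF card inf] unfolding Field_Restr_underS
    by (fastforce simp: osup_def underS_def)
  moreover have "osup \<kappa> (underS \<kappa> l) \<subseteq> underS \<kappa> l"
    using underS_trans by (auto simp: osup_def)
  moreover have "underS \<kappa> l \<noteq> {}"
    using inf unfolding Field_Restr_underS by auto
  ultimately show "l \<in> acc_ords \<kappa>"
    using l by (auto simp: acc_ords_def Reg_def)
qed

text \<open>If l is not a cardinal, l itself is an unbounded subset of smaller size; otherwise the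
  failure of regularity supplies one. Enumerating it by an ordinal c below l makes both the length c
  and all values \<open>k i\<close> regressive in l.\<close>

lemma singular_cofinal_map:
  assumes l: "l \<in> Field \<kappa>" and inf: "infinite (underS \<kappa> l)" and notReg: "l \<notin> Reg \<kappa>"
  shows "\<exists>c\<in>underS \<kappa> l. \<exists>k. (\<forall>i\<in>underS \<kappa> c. k i \<in> underS \<kappa> l) \<and>
           (\<forall>d\<in>underS \<kappa> l. \<exists>i\<in>underS \<kappa> c. k i \<notin> underS \<kappa> d)"
proof -
  define r where "r = Restr \<kappa> (underS \<kappa> l)"
  have Fr: "Field r = underS \<kappa> l"
    unfolding r_def by (rule Field_Restr_underS)
  have wr: "Well_order r"
    unfolding r_def using Well_order by (rule Well_order_Restr)
  have cf: "cinfinite r"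
    using inf by (simp add: cinfinite_def Fr)
  have "\<exists>K\<subseteq>underS \<kappa> l. |K| <o r \<and> (\<forall>d\<in>underS \<kappa> l. \<exists>x\<in>K. x \<notin> underS \<kappa> d)"
  proof (cases "Card_order r")
    case False
    then have "|Field r| <o r"
      using not_ordLeq_iff_ordLess[OF card_of_Well_order wr, of "Field r"]
      by (simp add: Card_order_iff_ordLeq_card_of)
    moreover have "\<exists>x\<in>underS \<kappa> l. x \<notin> underS \<kappa> d" if "d \<in> underS \<kappa> l" for d
      using that underS_notIn[of d \<kappa>] by blast
    ultimately show ?thesis
      unfolding Fr by (intro exI[of _ "underS \<kappa> l"]) simp
  next
    case True
    then have "\<not> regularCard r"
      using notReg cf l by (auto simp: Reg_def r_def)
    then obtain K where K: "K \<subseteq> Field r" "cofinal K r" "\<not> |K| =o r"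
      by (auto simp: regularCard_def)
    have "|K| \<le>o r"
      by (rule ordLeq_ordIso_trans[OF card_of_mono1[OF K(1)] card_of_Field_ordIso[OF True]])
    then have "|K| <o r"
      using K(3) by (simp add: ordLeq_iff_ordLess_or_ordIso)
    moreover have "\<exists>x\<in>K. x \<notin> underS \<kappa> d" if d: "d \<in> underS \<kappa> l" for d
    proof -
      obtain x where "x \<in> K" "d \<noteq> x" "(d, x) \<in> r"
        using K(2) d unfolding cofinal_def Fr by blast
      then have "d \<in> underS \<kappa> x"
        by (auto simp: r_def underS_def)
      then show ?thesis
        using underS_asym \<open>x \<in> K\<close> by blast
    qed
    ultimately show ?thesis
      using K(1) Fr by blast
  qed
  then obtain K where K: "K \<subseteq> underS \<kappa> l" "|K| <o r"
    "\<And>d. d \<in> underS \<kappa> l \<Longrightarrow> \<exists>x\<in>K. x \<notin> underS \<kappa> d"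
    by blast
  \<comment> \<open>A well-order shorter than \<open>r\<close> is isomorphic to a proper initial
    segment of \<open>r\<close>, and this segment provides the length c.\<close>
  obtain c where c: "c \<in> Field r" "|K| =o Restr r (underS r c)"
    using ordLess_iff_ordIso_Restr[OF wr card_of_Well_order, of K] K(2) by blast
  have cl: "c \<in> underS \<kappa> l"
    using c(1) Fr by simp
  have "underS r c \<subseteq> underS \<kappa> c"
    unfolding r_def by (auto simp: underS_def)
  moreover have "underS \<kappa> c \<subseteq> underS r c"
    using cl underS_trans[OF _ cl] unfolding r_def by (auto simp: underS_def)
  ultimately have Uc: "underS r c = underS \<kappa> c" ..
  have "Field (Restr r (underS r c)) = underS r c"
    using wr by (intro Refl_Field_Restr2 Order_Relation.underS_Field) (simp add: order_on_defs)
  then have "|K| =o |underS \<kappa> c|"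
    using card_of_cong[OF c(2)] by (simp add: Uc Field_card_of)
  then obtain k where "bij_betw k (underS \<kappa> c) K"
    using ordIso_symmetric[of "|K|"] card_of_ordIso[of "underS \<kappa> c" K] by blast
  then have k: "k ` underS \<kappa> c = K"
    by (simp add: bij_betw_def)
  show ?thesis
    using cl k K by (intro bexI[of _ c] exI[of _ k]) blast+
qed

end

section \<open>Consequences of the partition property\<close>

lemma weakly_compact_homogeneous:
  fixes f :: "'a set \<Rightarrow> bool"
  assumes "weakly_compact \<kappa>"
  obtains H c where "H \<in> full_subsets \<kappa>" "\<And>X. X \<in> [H]\<^bsup>2\<^esup> \<Longrightarrow> f X = c"
proof -
  have "\<exists>H\<in>full_subsets \<kappa>. \<exists>c. \<forall>X\<in>[H]\<^bsup>2\<^esup>. f X = c"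
    using assms by (simp add: weakly_compact_def)
  then show thesis
    using that by blast
qed

text \<open>Let \<open>K\<close> be cofinal and small, and let \<open>b x\<close> be an element of
  \<open>K\<close> above x. Colour a pair by whether \<open>b\<close> agrees on it. A homogeneous
  \<open>H\<close> is either mapped injectively into \<open>K\<close> or lies below a single element
  of \<open>K\<close>, so it is too small in both cases.\<close>

lemma weakly_compact_regular:
  assumes "weakly_compact \<kappa>"
  shows "regular_cardinal \<kappa>"
proof
  show card: "Card_order \<kappa>" and unc: "natLeq <o \<kappa>"
    using assms by (auto simp: weakly_compact_def)
  show "regularCard \<kappa>"
    unfolding regularCard_def
  proof (intro allI impI)
    fix K assume K: "K \<subseteq> Field \<kappa> \<and> cofinal K \<kappa>"
    show "|K| =o \<kappa>"
    proof (rule ccontr)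
      assume neq: "\<not> |K| =o \<kappa>"
      have "|K| \<le>o \<kappa>"
        using K by (intro ordLeq_ordIso_trans[OF card_of_mono1 card_of_Field_ordIso[OF card]]) simp
      then have small: "|K| <o \<kappa>"
        using neq by (simp add: ordLeq_iff_ordLess_or_ordIso)
      obtain b where b: "\<And>x. x \<in> Field \<kappa> \<Longrightarrow> b x \<in> K \<and> x \<in> underS \<kappa> (b x)"
        using K unfolding cofinal_def underS_def by (simp, metis)
      obtain H c where H: "H \<in> full_subsets \<kappa>"
        and c: "\<And>X. X \<in> [H]\<^bsup>2\<^esup> \<Longrightarrow> (\<exists>k. b ` X = {k}) = c"
        by (rule weakly_compact_homogeneous[OF assms, of "\<lambda>X. \<exists>k. b ` X = {k}"]) blast
      have HF: "H \<subseteq> Field \<kappa>"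
        using H by (simp add: full_subsets_def)
      have col: "(b x = b y) = c" if "x \<in> H" "y \<in> H" "x \<noteq> y" for x y
        using c[of "{x, y}"] that by auto
      have "|H| <o \<kappa>"
      proof (cases c)
        case False
        then have "inj_on b H"
          using col by (auto simp: inj_on_def)
        moreover have "b ` H \<subseteq> K"
          using b HF by blast
        ultimately have "|H| \<le>o |K|"
          using card_of_ordLeq[of H K] by blast
        then show ?thesis
          by (rule ordLeq_ordLess_trans[OF _ small])
      next
        case True
        show ?thesis
        proof (cases "H = {}")
          case False
          then obtain x where x: "x \<in> H"
            by blast
          have "H \<subseteq> underS \<kappa> (b x)"
            using b col True x HF by (metis subset_iff)
          moreover have "|underS \<kappa> (b x)| <o \<kappa>"
            using card_of_underS[OF card] b x HF K by blast
          ultimately show ?thesis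
            by (rule ordLeq_ordLess_trans[OF card_of_mono1])
        next
          case True
          then show ?thesis
            by (intro finite_ordLess_uncountable[OF unc]) simp
        qed
      qed
      then show False
        using H not_ordLess_ordIso by (auto simp: full_subsets_def)
    qed
  qed
qed

text \<open>Each x yields the bit sequence of its memberships in the sets \<open>X i\<close>.
  Colouring x < y by whether these sequences increase lexicographically makes them monotone along a
  homogeneous \<open>H\<close>. By induction on i, every coordinate of such a \<kappa>-sequence
  stabilises.\<close>

lemma (in regular_cardinal) ev_decided:
  fixes X :: "'a \<Rightarrow> 'a set"
  assumes "weakly_compact \<kappa>"
  shows "\<exists>H\<in>full_subsets \<kappa>. \<forall>i\<in>Field \<kappa>. \<exists>c. ev H (\<lambda>x. (x \<in> X i) = c)"
proof -
  define lex where "lex x y \<longleftrightarrow> (\<exists>i\<in>Field \<kappa>. x \<notin> X i \<and> y \<in> X i \<and> (\<forall>j\<in>underS \<kappa> i. x \<in> X j \<longleftrightarrow> y \<in> X j))"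
    for x y
  define f where "f P \<longleftrightarrow> (\<exists>x y. P = {x, y} \<and> x \<in> underS \<kappa> y \<and> lex x y)" for P
  obtain H c where H: "H \<in> full_subsets \<kappa>" and c: "\<And>P. P \<in> [H]\<^bsup>2\<^esup> \<Longrightarrow> f P = c"
    by (rule weakly_compact_homogeneous[OF assms, of f]) blast
  have col: "lex x y = c" if "x \<in> H" "y \<in> H" "x \<in> underS \<kappa> y" for x y
  proof -
    have "x \<noteq> y"
      using that(3) by (auto simp: underS_def)
    then have "f {x, y} = c"
      using c that by simp
    moreover have "f {x, y} = lex x y"
      unfolding f_def using that(3) underS_asym by (auto simp: doubleton_eq_iff)
    ultimately show ?thesis
      by simp
  qed
  have "\<exists>c. ev H (\<lambda>x. (x \<in> X i) = c)" if "i \<in> Field \<kappa>" for i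
    using that
  proof (induction rule: underS_induct)
    case (less i)
    then obtain d where d: "\<And>j. j \<in> underS \<kappa> i \<Longrightarrow> ev H (\<lambda>x. (x \<in> X j) = d j)"
      by metis
    have "ev H (\<lambda>x. \<forall>j\<in>underS \<kappa> i. (x \<in> X j) = d j)"
      by (rule ev_ball[OF small_underS[OF less.hyps] d])
    then obtain b where b: "b \<in> Field \<kappa>"
      and bd: "\<And>x j. x \<in> H \<Longrightarrow> b \<in> underS \<kappa> x \<Longrightarrow> j \<in> underS \<kappa> i \<Longrightarrow> (x \<in> X j) = d j"
      unfolding ev_def by blast
    \<comment> \<open>Beyond b the sequences agree below i, so i is the first place where they can
      differ. Lexicographic monotonicity thus becomes monotonicity of bit i, upwards if c holds and
      downwards otherwise.\<close>
    have mono: "if c then x \<in> X i \<longrightarrow> y \<in> X i else y \<in> X i \<longrightarrow> x \<in> X i"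
      if x: "x \<in> H" "b \<in> underS \<kappa> x" and y: "y \<in> H" "x \<in> underS \<kappa> y" for x y
    proof -
      have by': "b \<in> underS \<kappa> y"
        using x y underS_trans by blast
      have agree: "x \<in> X j \<longleftrightarrow> y \<in> X j" if "j \<in> underS \<kappa> i" for j
        using bd[OF x that] bd[OF y(1) by' that] by simp
      show ?thesis
      proof (cases c)
        case True
        then obtain k where k: "k \<in> Field \<kappa>" "x \<notin> X k" "y \<in> X k"
          "\<And>j. j \<in> underS \<kappa> k \<Longrightarrow> x \<in> X j \<longleftrightarrow> y \<in> X j"
          using col[OF x(1) y] unfolding lex_def by blast
        then have "k = i \<or> i \<in> underS \<kappa> k"
          using underS_total[OF k(1) less.hyps] agree by blast
        then show ?thesis
          using k True by auto
      next
        case False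
        then show ?thesis
          using col[OF x(1) y] agree less.hyps unfolding lex_def by auto
      qed
    qed
    \<comment> \<open>A monotone bit changes at most once: the value c persists once it occurs, and
      if it never occurs beyond b, the bit is constantly the other value.\<close>
    show ?case
    proof (cases "\<exists>x\<in>H. b \<in> underS \<kappa> x \<and> (x \<in> X i) = c")
      case True
      then obtain x where x: "x \<in> H" "b \<in> underS \<kappa> x" "(x \<in> X i) = c"
        by blast
      have "(y \<in> X i) = c" if "y \<in> H" "x \<in> underS \<kappa> y" for y
        using mono[OF x(1,2) that] x(3) by (auto split: if_splits)
      then show ?thesis
        unfolding ev_def using underS_in_Field(2)[OF x(2)] by blast
    next
      case False
      then have "ev H (\<lambda>x. (x \<in> X i) = (\<not> c))"
        unfolding ev_def using b by blast
      then show ?thesis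
        by blast
    qed
  qed
  then show ?thesis
    using H by blast
qed

text \<open>
  A form of normality. In terms of an ultrapower, the composite \<open>F\<close>
  found in the proof is the function that represents \<open>\<kappa>\<close>.
\<close>

lemma (in regular_cardinal) regressive_ev_const:
  fixes \<G> :: "('a \<Rightarrow> 'a) set"
  assumes wc: "weakly_compact \<kappa>" and card\<G>: "|\<G>| \<le>o \<kappa>"
  shows "\<exists>L. unbounded L \<and>
    (\<forall>g\<in>\<G>. \<exists>c\<in>Field \<kappa>. ev L (\<lambda>x. g x \<in> underS \<kappa> x \<longrightarrow> g x = c))"
proof -
  obtain a where "a \<in> Field \<kappa>"
    using infinite_Field infinite_imp_nonempty by blast
  then obtain z where z: "z \<in> Field \<kappa>" "underS \<kappa> z = {}"
    by (rule least_in_Field[where P = "\<lambda>_. True"]) auto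
  \<comment> \<open>\<open>g\<close> made regressive everywhere above \<open>z = 0\<close>\<close>
  define R where "R g x = (if g x \<in> underS \<kappa> x then g x else z)" for g x
  have R_Field: "R g x \<in> Field \<kappa>" for g x
    using z by (auto simp: R_def underS_in_Field)
  have R_less: "R g x \<in> underS \<kappa> x" if "z \<in> underS \<kappa> x" for g x
    using that by (auto simp: R_def)
  define W where "W n = ((\<lambda>X. (\<lambda>(g, F). R g \<circ> F) ` (\<G> \<times> X)) ^^ n) {id}" for n
  have W_Suc: "W (Suc n) = (\<lambda>(g, F). R g \<circ> F) ` (\<G> \<times> W n)" for n
    by (simp add: W_def)
  \<comment> \<open>Finite compositions of the maps \<open>R g\<close>, including \<open>id\<close>:
    at most \<kappa> functions, closed under a further \<open>R g\<close> on the left.\<close>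
  define \<F> where "\<F> = (\<Union>n. W n)"
  have id\<F>: "id \<in> \<F>"
    unfolding \<F>_def using UN_I[of 0 UNIV id W] by (simp add: W_def)
  have comp\<F>: "R g \<circ> F \<in> \<F>" if g: "g \<in> \<G>" and F: "F \<in> \<F>" for g F
  proof -
    obtain n where "F \<in> W n"
      using F by (auto simp: \<F>_def)
    then have "R g \<circ> F \<in> W (Suc n)"
      using g unfolding W_Suc by force
    then show ?thesis
      by (auto simp: \<F>_def)
  qed
  have W_Field: "F \<in> W n \<Longrightarrow> x \<in> Field \<kappa> \<Longrightarrow> F x \<in> Field \<kappa>" for F n x
    by (cases n) (auto simp: W_def R_Field)
  then have \<F>_Field: "F x \<in> Field \<kappa>" if "F \<in> \<F>" "x \<in> Field \<kappa>" for F x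
    using that by (auto simp: \<F>_def)
  have "|W n| \<le>o \<kappa>" for n
  proof (induction n)
    case 0
    have "|W 0| \<le>o |Field \<kappa>|"
      using z by (intro card_of_ordLeqI[of "\<lambda>_. z"]) (auto simp: W_def)
    then show ?case
      by (rule ordLeq_ordIso_trans[OF _ card_of_Field_ordIso[OF Card_order]])
  next
    case (Suc n)
    have "|\<G> \<times> W n| \<le>o \<kappa>"
      by (rule card_of_Times_ordLeq_infinite_Field[OF infinite_Field card\<G> Suc Card_order])
    then show ?case
      unfolding W_Suc by (rule ordLeq_transitive[OF card_of_image])
  qed
  then have "|\<F>| \<le>o \<kappa>"
    unfolding \<F>_def
    by (intro card_of_UNION_ordLeq_infinite_Field[OF infinite_Field])
      (auto simp: Card_order ordLess_imp_ordLeq[OF small_nat])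
  then have "|\<F> \<times> Field \<kappa>| \<le>o |Field \<kappa>|"
    using card_of_Times_ordLeq_infinite_Field[OF infinite_Field _ _ Card_order]
      card_of_Field_ordIso[OF Card_order] ordIso_imp_ordLeq ordIso_symmetric ordLeq_ordIso_trans
    by metis
  then obtain e where e: "inj_on e (\<F> \<times> Field \<kappa>)" "e ` (\<F> \<times> Field \<kappa>) \<subseteq> Field \<kappa>"
    using card_of_ordLeq[of "\<F> \<times> Field \<kappa>" "Field \<kappa>"] by blast
  \<comment> \<open>The injection \<open>e\<close> codes pairs (F, y) by ordinals below \<kappa>, so
    that one use of \<open>ev_decided\<close> decides all level sets F x = y. Indices outside the
    range of \<open>e\<close> give arbitrary sets.\<close>
  define X where "X i = {x. case inv_into (\<F> \<times> Field \<kappa>) e i of (F, y) \<Rightarrow> F x = y}" for i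
  obtain H where H: "H \<in> full_subsets \<kappa>" "\<And>i. i \<in> Field \<kappa> \<Longrightarrow> \<exists>c. ev H (\<lambda>x. (x \<in> X i) = c)"
    using ev_decided[OF wc, of X] by blast
  have unbH: "unbounded H"
    by (rule full_imp_unbounded[OF H(1)])
  then have HF: "H \<subseteq> Field \<kappa>"
    by (simp add: unbounded_def)
  have dec: "ev H (\<lambda>x. F x = y) \<or> ev H (\<lambda>x. F x \<noteq> y)" if "F \<in> \<F>" "y \<in> Field \<kappa>" for F y
  proof -
    have "(F, y) \<in> \<F> \<times> Field \<kappa>"
      using that by simp
    then have "e (F, y) \<in> Field \<kappa>" "X (e (F, y)) = {x. F x = y}"
      using e by (auto simp: X_def inv_into_f_f)
    then obtain c where "ev H (\<lambda>x. (F x = y) = c)"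
      using H(2)[of "e (F, y)"] by auto
    then show ?thesis
      by (cases c) auto
  qed
  define D where "D F \<longleftrightarrow> F \<in> \<F> \<and> (\<forall>y\<in>Field \<kappa>. ev H (\<lambda>x. y \<in> underS \<kappa> (F x)))" for F
  \<comment> \<open>If F eventually takes no fixed value, \<open>dec\<close> says that each value is
    eventually avoided. By \<kappa>-completeness all values up to y are avoided together, so F
    diverges along \<open>H\<close>.\<close>
  have dich: "D F" if F: "F \<in> \<F>" and nc: "\<And>y. y \<in> Field \<kappa> \<Longrightarrow> \<not> ev H (\<lambda>x. F x = y)" for F
    unfolding D_def
  proof (intro conjI ballI F)
    fix y assume y: "y \<in> Field \<kappa>"
    have ne: "ev H (\<lambda>x. F x \<noteq> w)" if "w \<in> Field \<kappa>" for w
      using dec[OF F that] nc[OF that] by blast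
    have "ev H (\<lambda>x. \<forall>w\<in>underS \<kappa> y. F x \<noteq> w)"
      by (rule ev_ball[OF small_underS[OF y]]) (use ne underS_in_Field in blast)
    from ev_conj[OF this ne[OF y]]
    show "ev H (\<lambda>x. y \<in> underS \<kappa> (F x))"
    proof (rule ev_mono)
      fix x assume "x \<in> H" "(\<forall>w\<in>underS \<kappa> y. F x \<noteq> w) \<and> F x \<noteq> y"
      then show "y \<in> underS \<kappa> (F x)"
        using underS_total[OF y \<F>_Field[OF F, of x]] HF by blast
    qed
  qed
  \<comment> \<open>Without a minimal divergent composite there is an infinite chain, each member
    obtained from the previous one by some \<open>R g\<close>. Countably many tails of
    \<open>H\<close> share a point x at which every member exceeds z; there each \<open>R g\<close>
    strictly decreases, giving an infinite descent of ordinals.\<close>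
  have "\<exists>F. D F \<and> (\<forall>g\<in>\<G>. \<not> D (R g \<circ> F))"
  proof (rule ccontr)
    assume "\<not> ?thesis"
    then have step: "\<exists>F'. D F' \<and> (\<exists>g. F' = R g \<circ> F)" if "D F" for F
      using that by blast
    have "D id"
      using id\<F> ev_above by (simp add: D_def)
    then obtain Fs where Fs: "\<And>n. D (Fs n)" "\<And>n. \<exists>g. Fs (Suc n) = R g \<circ> Fs n"
      using dependent_nat_choice[of "\<lambda>_. D" "\<lambda>_ F F'. \<exists>g. F' = R g \<circ> F"] step by metis
    have "ev H (\<lambda>x. \<forall>n\<in>UNIV. z \<in> underS \<kappa> (Fs n x))"
      by (rule ev_ball[OF small_nat]) (use Fs(1) z D_def in blast)
    then obtain x where x: "x \<in> H" "\<And>n. z \<in> underS \<kappa> (Fs n x)"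
      using ev_exists[OF unbH] by blast
    have "Fs (Suc n) x \<in> underS \<kappa> (Fs n x)" for n
      using Fs(2)[of n] R_less[OF x(2)] by auto
    then have "(Fs (Suc n) x, Fs n x) \<in> \<kappa> - Id" for n
      by (auto simp: underS_def)
    then show False
      using wf_no_infinite_down_chainE[OF wf_less, of "\<lambda>n. Fs n x"] by blast
  qed
  then obtain F where F: "D F" and F_min: "\<And>g. g \<in> \<G> \<Longrightarrow> \<not> D (R g \<circ> F)"
    by blast
  have F\<F>: "F \<in> \<F>" and F_div: "\<And>y. y \<in> Field \<kappa> \<Longrightarrow> ev H (\<lambda>x. y \<in> underS \<kappa> (F x))"
    using F by (auto simp: D_def)
  \<comment> \<open>\<open>F\<close> need not be monotone, but its values below b' are bounded by
    some m. Thus F x > m forces x \<ge> b' > b, and a tail of the image comes from a tail of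
    \<open>H\<close>.\<close>
  have ev_image: "ev (F ` H) P" if "ev H (\<lambda>x. P (F x))" for P
  proof -
    obtain b where b: "b \<in> Field \<kappa>" "\<And>x. x \<in> H \<Longrightarrow> b \<in> underS \<kappa> x \<Longrightarrow> P (F x)"
      using \<open>ev H (\<lambda>x. P (F x))\<close> unfolding ev_def by blast
    obtain b' where b': "b' \<in> Field \<kappa>" "b \<in> underS \<kappa> b'"
      using above_exists b(1) by blast
    obtain m where m: "m \<in> Field \<kappa>" "\<And>x. x \<in> underS \<kappa> b' \<Longrightarrow> F x \<in> underS \<kappa> m"
      using small_image_bounded[OF _ small_underS[OF b'(1)], of F] \<F>_Field[OF F\<F>] underS_in_Field
      by (metis image_subsetI)
    have "P (F x)" if "x \<in> H" "m \<in> underS \<kappa> (F x)" for x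
    proof -
      have "x \<notin> underS \<kappa> b'"
        using m(2) that(2) underS_asym by blast
      then have "b \<in> underS \<kappa> x"
        using underS_total[of x b'] HF that(1) b' underS_trans by blast
      then show ?thesis
        using b(2) that(1) by blast
    qed
    then show ?thesis
      unfolding ev_def using m(1) by blast
  qed
  have "unbounded (F ` H)"
    unfolding unbounded_def
  proof (intro conjI ballI)
    show "F ` H \<subseteq> Field \<kappa>"
      using \<F>_Field[OF F\<F>] HF by blast
    show "\<exists>x\<in>F ` H. a \<in> underS \<kappa> x" if "a \<in> Field \<kappa>" for a
      using ev_exists[OF unbH F_div[OF that]] by blast
  qed
  \<comment> \<open>By minimality \<open>R g \<circ> F\<close> does not diverge, so it is eventually
    constant along \<open>H\<close>. Hence \<open>R g\<close> is eventually constant on the image of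
    \<open>H\<close> under \<open>F\<close>, and it equals \<open>g\<close> wherever
    \<open>g\<close> is regressive.\<close>
  moreover have "\<exists>c\<in>Field \<kappa>. ev (F ` H) (\<lambda>x. g x \<in> underS \<kappa> x \<longrightarrow> g x = c)" if g: "g \<in> \<G>" for g
  proof -
    obtain c where c: "c \<in> Field \<kappa>" "ev H (\<lambda>x. (R g \<circ> F) x = c)"
      using dich[OF comp\<F>[OF g F\<F>]] F_min[OF g] by blast
    have "ev (F ` H) (\<lambda>x. R g x = c)"
      using c(2) by (intro ev_image) simp
    then have "ev (F ` H) (\<lambda>x. g x \<in> underS \<kappa> x \<longrightarrow> g x = c)"
      by (rule ev_mono) (auto simp: R_def split: if_splits)
    then show ?thesis
      using c(1) by blast
  qed
  ultimately show ?thesis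
    by blast
qed

section \<open>Refutation of the guessing principle\<close>

lemma (in regular_cardinal) infinite_underS_exists: "\<exists>w\<in>Field \<kappa>. infinite (underS \<kappa> w)"
proof -
  obtain u :: "nat \<Rightarrow> 'a" where u: "inj u" "range u \<subseteq> Field \<kappa>"
    using infinite_Field infinite_countable_subset by blast
  obtain w where w: "w \<in> Field \<kappa>" "\<And>n. u n \<in> underS \<kappa> w"
    by (rule small_image_bounded[OF u(2) small_nat]) simp
  have "infinite (range u)"
    using u(1) by (rule range_inj_infinite)
  then have "infinite (underS \<kappa> w)"
    using w(2) by (meson finite_subset image_subsetI)
  then show ?thesis
    using w(1) by blast
qed

theorem theorem2p30:
  fixes \<kappa> :: "'a rel" and S :: "'a set"
  assumes "weakly_compact \<kappa>"
    and "Reg \<kappa> \<subseteq> S" and "S \<subseteq> Field \<kappa>"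
  shows "\<not> clubsuit_AD_1_1 \<kappa> S"
proof
  interpret regular_cardinal \<kappa>
    by (rule weakly_compact_regular[OF assms(1)])
  assume "clubsuit_AD_1_1 \<kappa> S"
  then obtain \<A> where AD: "AD_multi_ladder_system \<kappa> S \<A>"
    and one: "\<And>\<alpha>. \<alpha> \<in> S \<Longrightarrow> card (\<A> \<alpha>) = 1"
    and guess: "\<And>B. B \<in> full_subsets \<kappa> \<Longrightarrow>
      stationary_in \<kappa> {\<alpha> \<in> S. \<forall>A\<in>\<A> \<alpha>. osup \<kappa> (A \<inter> B) = underS \<kappa> \<alpha>}"
    unfolding clubsuit_AD_1_1_def by blast
  have "\<exists>A. \<A> \<alpha> = {A}" if "\<alpha> \<in> S" for \<alpha>
    using one[OF that] by (rule card_1_singletonE) blast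
  then obtain T where T: "\<And>\<alpha>. \<alpha> \<in> S \<Longrightarrow> \<A> \<alpha> = {T \<alpha>}"
    by metis
  have T_sub: "T \<alpha> \<subseteq> underS \<kappa> \<alpha>"
    and T_cof: "\<And>x. x \<in> underS \<kappa> \<alpha> \<Longrightarrow> \<exists>y\<in>T \<alpha>. x \<in> underS \<kappa> y"
    if "\<alpha> \<in> S" "\<alpha> \<in> acc_ords \<kappa>" for \<alpha>
  proof -
    have *: "T \<alpha> \<subseteq> underS \<kappa> \<alpha> \<and> cofinal (T \<alpha>) (Restr \<kappa> (underS \<kappa> \<alpha>))"
      using AD that T[OF that(1)] by (simp add: AD_multi_ladder_system_def)
    then show "T \<alpha> \<subseteq> underS \<kappa> \<alpha>"
      by blast
    show "\<exists>y\<in>T \<alpha>. x \<in> underS \<kappa> y" if "x \<in> underS \<kappa> \<alpha>" for x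
      using * that unfolding cofinal_def Field_Restr_underS by (fastforce simp: underS_def)
  qed
  have T_AD: "osup \<kappa> (T \<alpha> \<inter> T \<beta>) \<subset> osup \<kappa> (T \<alpha>)" if "\<alpha> \<in> S" "\<beta> \<in> S" "T \<alpha> \<noteq> T \<beta>" for \<alpha> \<beta>
  proof -
    have "T \<alpha> \<in> (\<Union>\<alpha>\<in>S. \<A> \<alpha>)" "T \<beta> \<in> (\<Union>\<alpha>\<in>S. \<A> \<alpha>)"
      using that T by blast+
    then show ?thesis
      using conjunct2[OF conjunct2[OF AD[unfolded AD_multi_ladder_system_def]], rule_format] that(3)
      by simp
  qed

  obtain c k where ck: "\<And>l. l \<in> Field \<kappa> \<Longrightarrow> infinite (underS \<kappa> l) \<Longrightarrow> l \<notin> Reg \<kappa> \<Longrightarrow>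
      c l \<in> underS \<kappa> l \<and> (\<forall>i\<in>underS \<kappa> (c l). k l i \<in> underS \<kappa> l) \<and>
      (\<forall>d\<in>underS \<kappa> l. \<exists>i\<in>underS \<kappa> (c l). k l i \<notin> underS \<kappa> d)"
    using singular_cofinal_map by metis
  \<comment> \<open>For fixed d this is regressive in l on \<open>Reg \<kappa>\<close> above d,
    because the ladder \<open>T l\<close> lies below l.\<close>
  define g where "g d l = (SOME y. y \<in> T l \<and> d \<in> underS \<kappa> y)" for d l
  have g: "g d l \<in> T l \<and> d \<in> underS \<kappa> (g d l)" if "l \<in> Reg \<kappa>" "d \<in> underS \<kappa> l" for d l
    unfolding g_def
    by (rule someI_ex) (use T_cof[of l d] that Reg_subset_acc_ords assms(2) in blast)
  define \<G> where "\<G> = insert c ((\<lambda>i l. k l i) ` Field \<kappa> \<union> g ` Field \<kappa>)"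
  have image_le: "|f ` Field \<kappa>| \<le>o \<kappa>" for f :: "'a \<Rightarrow> 'a \<Rightarrow> 'a"
    by (rule ordLeq_ordIso_trans[OF card_of_image card_of_Field_ordIso[OF Card_order]])
  have "|{c}| \<le>o \<kappa>"
    by (rule ordLess_imp_ordLeq[OF finite_ordLess_uncountable[OF uncountable]]) simp
  then have "|{c} \<union> ((\<lambda>i l. k l i) ` Field \<kappa> \<union> g ` Field \<kappa>)| \<le>o \<kappa>"
    by (intro card_of_Un_ordLeq_infinite_Field infinite_Field image_le Card_order)
  then have "|\<G>| \<le>o \<kappa>"
    by (simp add: \<G>_def)
  then obtain L where L: "unbounded L"
    and const: "\<And>h. h \<in> \<G> \<Longrightarrow> \<exists>c\<in>Field \<kappa>. ev L (\<lambda>x. h x \<in> underS \<kappa> x \<longrightarrow> h x = c)"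
    using regressive_ev_const[OF assms(1)] by blast
  have LF: "L \<subseteq> Field \<kappa>"
    using L by (simp add: unbounded_def)

  \<comment> \<open>On a tail of \<open>L\<close>, all singular l would share the length c0 and the
    cofinal map v. The c0 many values of v have a bound d below \<kappa>, so v cannot be unbounded
    in any l > d.\<close>
  have ev_Reg: "ev L (\<lambda>l. l \<in> Reg \<kappa>)"
  proof -
    obtain w where w: "w \<in> Field \<kappa>" "infinite (underS \<kappa> w)"
      using infinite_underS_exists by blast
    obtain c0 where c0: "c0 \<in> Field \<kappa>" "ev L (\<lambda>l. c l \<in> underS \<kappa> l \<longrightarrow> c l = c0)"
      using const[of c] by (auto simp: \<G>_def)
    have "\<exists>v\<in>Field \<kappa>. ev L (\<lambda>l. k l i \<in> underS \<kappa> l \<longrightarrow> k l i = v)" if "i \<in> underS \<kappa> c0" for i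
      using const[of "\<lambda>l. k l i"] underS_in_Field(1)[OF that] by (simp add: \<G>_def)
    then obtain v where v: "\<And>i. i \<in> underS \<kappa> c0 \<Longrightarrow> v i \<in> Field \<kappa>"
      "\<And>i. i \<in> underS \<kappa> c0 \<Longrightarrow> ev L (\<lambda>l. k l i \<in> underS \<kappa> l \<longrightarrow> k l i = v i)"
      by metis
    obtain d where d: "d \<in> Field \<kappa>" "\<And>i. i \<in> underS \<kappa> c0 \<Longrightarrow> v i \<in> underS \<kappa> d"
      using small_image_bounded[OF _ small_underS[OF c0(1)], of v] v(1) by (metis image_subsetI)
    have "ev L (\<lambda>l. (\<forall>i\<in>underS \<kappa> c0. k l i \<in> underS \<kappa> l \<longrightarrow> k l i = v i) \<and>
        (c l \<in> underS \<kappa> l \<longrightarrow> c l = c0) \<and> w \<in> underS \<kappa> l \<and> d \<in> underS \<kappa> l)"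
      by (intro ev_conj ev_ball small_underS c0 v ev_above w d)
    then show ?thesis
    proof (rule ev_mono)
      fix l assume l: "l \<in> L" and *: "(\<forall>i\<in>underS \<kappa> c0. k l i \<in> underS \<kappa> l \<longrightarrow> k l i = v i) \<and>
        (c l \<in> underS \<kappa> l \<longrightarrow> c l = c0) \<and> w \<in> underS \<kappa> l \<and> d \<in> underS \<kappa> l"
      show "l \<in> Reg \<kappa>"
      proof (rule ccontr)
        assume nR: "l \<notin> Reg \<kappa>"
        have "underS \<kappa> w \<subseteq> underS \<kappa> l"
          using * underS_trans by blast
        then have inf: "infinite (underS \<kappa> l)"
          using w(2) finite_subset by blast
        note ckl = ck[OF subsetD[OF LF l] inf nR]
        then have "c l = c0"
          using * by blast
        then obtain i where i: "i \<in> underS \<kappa> c0" "k l i \<in> underS \<kappa> l" "k l i \<notin> underS \<kappa> d"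
          using ckl * by blast
        then have "k l i = v i"
          using * by blast
        then show False
          using i d(2) by simp
      qed
    qed
  qed

  have "\<exists>b\<in>Field \<kappa>. ev L (\<lambda>l. g d l \<in> underS \<kappa> l \<longrightarrow> g d l = b)" if "d \<in> Field \<kappa>" for d
    using const[of "g d"] that by (simp add: \<G>_def)
  then obtain b where b: "\<And>d. d \<in> Field \<kappa> \<Longrightarrow> b d \<in> Field \<kappa>"
    "\<And>d. d \<in> Field \<kappa> \<Longrightarrow> ev L (\<lambda>l. g d l \<in> underS \<kappa> l \<longrightarrow> g d l = b d)"
    by metis
  \<comment> \<open>The eventual value \<open>b d\<close> inherits both properties of
    \<open>g d l\<close>; the second one, d < \<open>b d\<close>, no longer mentions l and makes
    \<open>B\<close> unbounded.\<close>
  have ev_b: "ev L (\<lambda>l. b d \<in> T l \<and> d \<in> underS \<kappa> (b d))" if d: "d \<in> Field \<kappa>" for d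
  proof (rule ev_mono[OF ev_conj[OF ev_Reg ev_conj[OF b(2)[OF d] ev_above[OF d]]]])
    fix l assume l: "l \<in> Reg \<kappa> \<and> (g d l \<in> underS \<kappa> l \<longrightarrow> g d l = b d) \<and> d \<in> underS \<kappa> l"
    then have gl: "g d l \<in> T l" "d \<in> underS \<kappa> (g d l)"
      using g by blast+
    then have "g d l \<in> underS \<kappa> l"
      using T_sub Reg_subset_acc_ords assms(2) l by blast
    then show "b d \<in> T l \<and> d \<in> underS \<kappa> (b d)"
      using gl l by auto
  qed
  define B where "B = b ` Field \<kappa>"
  have "unbounded B"
    unfolding unbounded_def B_def using b(1) ev_exists[OF L ev_b] by blast
  then have "stationary_in \<kappa> {\<alpha> \<in> S. \<forall>A\<in>\<A> \<alpha>. osup \<kappa> (A \<inter> B) = underS \<kappa> \<alpha>}"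
    by (intro guess unbounded_imp_full)
  then have "{\<alpha> \<in> S. \<forall>A\<in>\<A> \<alpha>. osup \<kappa> (A \<inter> B) = underS \<kappa> \<alpha>} \<inter> acc_ords \<kappa> \<noteq> {}"
    using club_acc_ords by (simp add: stationary_in_def)
  then obtain \<alpha> where \<alpha>: "\<alpha> \<in> S" "\<alpha> \<in> acc_ords \<kappa>" "osup \<kappa> (T \<alpha> \<inter> B) = underS \<kappa> \<alpha>"
    using T by auto
  have \<alpha>F: "\<alpha> \<in> Field \<kappa>"
    using \<alpha>(2) by (simp add: acc_ords_def)
  \<comment> \<open>Each element of \<open>B\<close> lies in \<open>T l\<close> for all large l in
    \<open>L\<close>. Fewer than \<kappa> of them are below \<alpha>, so a single tail serves them
    all.\<close>
  have "ev L (\<lambda>l. \<forall>y\<in>underS \<kappa> \<alpha>. y \<in> B \<longrightarrow> y \<in> T l)"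
  proof (rule ev_ball[OF small_underS[OF \<alpha>F]])
    fix y
    show "ev L (\<lambda>l. y \<in> B \<longrightarrow> y \<in> T l)"
    proof (cases "y \<in> B")
      case True
      then obtain d where d: "d \<in> Field \<kappa>" "y = b d"
        by (auto simp: B_def)
      show ?thesis
        by (rule ev_mono[OF ev_b[OF d(1)]]) (simp add: d(2))
    next
      case False
      then show ?thesis
        by (intro ev_mono[OF ev_above[OF \<alpha>F]]) simp
    qed
  qed
  from ev_exists[OF L ev_conj[OF this ev_conj[OF ev_Reg ev_above[OF \<alpha>F]]]]
  obtain l where l: "\<And>y. y \<in> underS \<kappa> \<alpha> \<Longrightarrow> y \<in> B \<Longrightarrow> y \<in> T l" "l \<in> Reg \<kappa>" "\<alpha> \<in> underS \<kappa> l"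
    by blast
  have lS: "l \<in> S" "l \<in> acc_ords \<kappa>"
    using l(2) assms(2) Reg_subset_acc_ords by blast+
  have sub: "T \<alpha> \<inter> B \<subseteq> T \<alpha> \<inter> T l"
    using l(1) T_sub[OF \<alpha>(1,2)] by blast
  \<comment> \<open>\<open>T l\<close> has an element above \<alpha>, whereas
    \<open>T \<alpha>\<close> lies below \<alpha>. Almost disjointness therefore applies, and the
    suprema below form the cycle \<alpha> \<le> sup(\<open>T \<alpha> \<inter> T l\<close>) <
    sup(\<open>T \<alpha>\<close>) \<le> \<alpha>.\<close>
  have "T \<alpha> \<noteq> T l"
    using T_cof[OF lS l(3)] T_sub[OF \<alpha>(1,2)] underS_asym by blast
  then have "osup \<kappa> (T \<alpha> \<inter> T l) \<subset> osup \<kappa> (T \<alpha>)"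
    by (rule T_AD[OF \<alpha>(1) lS(1)])
  also have "osup \<kappa> (T \<alpha>) \<subseteq> underS \<kappa> \<alpha>"
    using T_sub[OF \<alpha>(1,2)] underS_trans unfolding osup_def by blast
  also have "underS \<kappa> \<alpha> \<subseteq> osup \<kappa> (T \<alpha> \<inter> T l)"
    using sub unfolding \<alpha>(3)[symmetric] osup_def by blast
  finally show False
    by simp
qed

end
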